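(* Let $\{A_n\}_n$ and $\{A_n'\}_n$ be sparsely unbounded (s.u.) sequences of matrices and suppose that $\{B_{n,m}\}_n\xrightarrow{\rm a.c.s.}\{A_n\}_n$ and $\{B_{n,m}'\}_n\xrightarrow{\rm a.c.s.}\{A_n'\}_n$. Then $\{B_{n,m}\otimes B_{n,m}'\}_n\xrightarrow{\rm a.c.s.}\{A_n\otimes A_n'\}_n$.
   Context: A sequence of matrices is $\{A_n\}_n$ where $n$ varies in some infinite subset of $\mathbb N=\{1,2,\ldots\}$ (the same subset for all sequences involved) and $A_n$ is a complex matrix of size $d_n\times e_n$ with $d_n,e_n\to\infty$ as $n\to\infty$. $x\wedge y=\min(x,y)$; $\|\cdot\|$ is the spectral (operator 2-) norm; $\otimes$ is the Kronecker product, $X\otimes Y=[x_{ij}Y]_{i,j}$; $\sigma_i(A)$, $i=1,\ldots,m\wedge n$, are the singular values of $A\in\mathbb C^{m\times n}$. Sparsely unbounded: $\{A_n\}_n$, with $A_n$ of size $d_n\times e_n$, is s.u. if for every $M>0$ there exists $n_M$ such that, for $n\ge n_M$, $\frac{\#\{i\in\{1,\ldots,d_n\wedge e_n\}:\sigma_i(A_n)>M\}}{d_n\wedge e_n}\le r(M)$, where $r$ is a function of $M$ only with $\lim_{M\to\infty}r(M)=0$. Approximating class of sequences (a.c.s.): let $\{\{B_{n,m}\}_n\}_m$ be a sequence (indexed by $m$) of sequences of matrices with $B_{n,m}$ of the same size $d_n\times e_n$ as $A_n$. One writes $\{B_{n,m}\}_n\xrightarrow{\rm a.c.s.}\{A_n\}_n$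 if for every $m$ there exists $n_m$ such that, for $n\ge n_m$, $A_n=B_{n,m}+R_{n,m}+N_{n,m}$ with ${\rm rank}(R_{n,m})\le c(m)(d_n\wedge e_n)$ and $\|N_{n,m}\|\le\omega(m)$, where $n_m,c(m),\omega(m)$ depend only on $m$ and $\lim_{m\to\infty}c(m)=\lim_{m\to\infty}\omega(m)=0$. *)

theory Defs
  imports
    "HOL-Analysis.L2_Norm"
    "Jordan_Normal_Form.DL_Rank"
    "Jordan_Normal_Form.Schur_Decomposition"
begin

(* Block form [x_ij Y]: the entry (i, j) lies in block (i div rows Y, j div columns Y). *)
definition kronecker :: "complex mat \<Rightarrow> complex mat \<Rightarrow> complex mat" (infixl "\<otimes>\<^sub>K" 70) where
  "X \<otimes>\<^sub>K Y = mat (dim_row X * dim_row Y) (dim_col X * dim_col Y)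
     (\<lambda>(i, j). X $$ (i div dim_row Y, j div dim_col Y) * Y $$ (i mod dim_row Y, j mod dim_col Y))"

definition vec_norm2 :: "complex vec \<Rightarrow> real" where
  "vec_norm2 v = L2_set (\<lambda>i. cmod (v $ i)) {..<dim_vec v}"

(* The closed unit ball is used instead of the unit sphere, so that the set is nonempty
   also for matrices without columns; otherwise the two suprema agree. *)
definition spectral_norm :: "complex mat \<Rightarrow> real" where
  "spectral_norm A = Sup {vec_norm2 (A *\<^sub>v x) | x. x \<in> carrier_vec (dim_col A) \<and> vec_norm2 x \<le> 1}"

abbreviation mat_rank :: "complex mat \<Rightarrow> nat" where
  "mat_rank A \<equiv> vec_space.rank (dim_row A) A"

abbreviation min_dim :: "complex mat \<Rightarrow> nat" where
  "min_dim A \<equiv> min (dim_row A) (dim_col A)"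

(* The square roots of the eigenvalues of A* A, counted with algebraic multiplicity and
   sorted in decreasing order. If A has more columns than rows, the values beyond the
   first min_dim A ones are zeros that do not count as singular values.
   The list is indexed from 0. *)
definition singular_values :: "complex mat \<Rightarrow> real list" where
  "singular_values A = take (min_dim A)
     (rev (sorted_list_of_multiset
       (image_mset (\<lambda>z. sqrt (Re z)) (proots (char_poly (mat_adjoint A * A))))))"

(* A sequence indexed by n in I; values outside I are irrelevant. *)
definition matrix_sequence :: "nat set \<Rightarrow> (nat \<Rightarrow> complex mat) \<Rightarrow> bool" where
  "matrix_sequence I A \<longleftrightarrow> infinite I \<and> I \<subseteq> {1..} \<and>
     filterlim (\<lambda>n. dim_row (A n)) at_top (inf sequentially (principal I)) \<and>
     filterlim (\<lambda>n. dim_col (A n)) at_top (inf sequentially (principal I))"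

definition sparsely_unbounded :: "nat set \<Rightarrow> (nat \<Rightarrow> complex mat) \<Rightarrow> bool" where
  "sparsely_unbounded I A \<longleftrightarrow> matrix_sequence I A \<and>
     (\<exists>r :: real \<Rightarrow> real. (r \<longlongrightarrow> 0) at_top \<and>
       (\<forall>M > 0. \<exists>n\<^sub>M. \<forall>n \<in> I. n \<ge> n\<^sub>M \<longrightarrow>
          real (card {i. i < min_dim (A n) \<and> singular_values (A n) ! i > M})
            / real (min_dim (A n)) \<le> r M))"

(* The matrix B_{n,m} is written B n m; m ranges over the positive integers. *)
definition acs :: "nat set \<Rightarrow> (nat \<Rightarrow> nat \<Rightarrow> complex mat) \<Rightarrow> (nat \<Rightarrow> complex mat) \<Rightarrow> bool" where
  "acs I B A \<longleftrightarrow> matrix_sequence I A \<and>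
     (\<forall>m \<ge> 1. \<forall>n \<in> I. B n m \<in> carrier_mat (dim_row (A n)) (dim_col (A n))) \<and>
     (\<exists>c \<omega> :: nat \<Rightarrow> real. c \<longlonglongrightarrow> 0 \<and> \<omega> \<longlonglongrightarrow> 0 \<and>
       (\<forall>m \<ge> 1. \<exists>n\<^sub>m. \<forall>n \<in> I. n \<ge> n\<^sub>m \<longrightarrow>
         (\<exists>R \<in> carrier_mat (dim_row (A n)) (dim_col (A n)).
          \<exists>N \<in> carrier_mat (dim_row (A n)) (dim_col (A n)).
            A n = B n m + R + N \<and>
            real (mat_rank R) \<le> c m * real (min_dim (A n)) \<and>
            spectral_norm N \<le> \<omega> m)))"

end

theory Submission
  imports Defs
begin

text \<open>
  Truncating the singular value decomposition of \<open>A\<close> at level \<open>M\<close> gives \<open>A = H + T\<close>, where \<open>H\<close> has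
  rank at most the number of singular values above \<open>M\<close> and \<open>T\<close> has norm at most \<open>M\<close>; likewise
  \<open>A' = H' + T'\<close>. If \<open>A = B + R + N\<close> and \<open>A' = B' + R' + N'\<close>, expanding
  \<open>A \<otimes> A' - B \<otimes> B' = (R + N) \<otimes> A' + B \<otimes> (R' + N')\<close> with \<open>B = H + T - R - N\<close> in the term
  \<open>B \<otimes> N'\<close> and \<open>A' = H' + T'\<close> in \<open>N \<otimes> A'\<close> leaves products having a factor of small rank, and
  three products of norm at most \<open>\<omega> M\<close>, \<open>M \<omega>'\<close> and \<open>\<omega> \<omega>'\<close>. Both parts vanish in the limit if \<open>M\<close>
  depends on \<open>m\<close> and tends to infinity more slowly than \<open>1 / (\<omega> + \<omega>')\<close>.
\<close>

section \<open>Rank\<close>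

text \<open>Each index contributes an outer product, which has rank at most 1, so subadditivity of
  the rank gives the bound by induction. All later upper bounds on ranks of explicitly factored
  matrices are obtained this way.\<close>

lemma rank_le_card_sum_products:
  fixes A :: "'a :: field mat"
  assumes "finite S" and "A \<in> carrier_mat nr nc"
    and "\<And>i j. i < nr \<Longrightarrow> j < nc \<Longrightarrow> A $$ (i, j) = (\<Sum>l\<in>S. f l i * g l j)"
  shows "vec_space.rank nr A \<le> card S"
  using assms
proof (induction S arbitrary: A rule: finite_induct)
  case empty
  then have "A = 0\<^sub>m nr nc" by (intro eq_matI) auto
  then show ?case by (simp add: vec_space.rank_0I)
next
  case (insert s S)
  let ?P = "mat nr nc (\<lambda>(i, j). f s i * g s j)"
  let ?Q = "mat nr nc (\<lambda>(i, j). \<Sum>l\<in>S. f l i * g l j)"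
  have A: "A = ?P + ?Q"
    using insert by (intro eq_matI) auto
  have "vec_space.rank nr (?P + ?Q) \<le> vec_space.rank nr ?P + vec_space.rank nr ?Q"
    by (rule vec_space.rank_subadditive[where nc = nc]) auto
  moreover have "vec_space.rank nr ?P \<le> 1"
    by (rule vec_space.rank_le_1_product_entries[where nc = nc and f = "f s" and g = "g s"]) auto
  moreover have "vec_space.rank nr ?Q \<le> card S"
    by (rule insert.IH) auto
  ultimately show ?case
    using insert.hyps by (simp add: A)
qed

text \<open>The converse of \<open>rank_le_card_sum_products\<close>. A maximal independent set
  \<open>S\<close> of columns has \<open>rank A\<close> elements and spans all columns;
  \<open>g x j\<close> is the coefficient of \<open>x\<close> in column \<open>j\<close>. Indexing
  by the vectors themselves makes the cardinality of the index set equal to the rank.\<close>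

lemma rank_factorization:
  fixes A :: "'a :: field mat"
  assumes A: "A \<in> carrier_mat nr nc"
  shows "\<exists>(S :: 'a vec set) g. finite S \<and> card S = vec_space.rank nr A \<and>
    (\<forall>i<nr. \<forall>j<nc. A $$ (i, j) = (\<Sum>x\<in>S. x $ i * g x j))"
proof -
  interpret vec_space "TYPE('a)" nr .
  have colsA: "set (cols A) \<subseteq> carrier_vec nr"
    using cols_dim A by blast
  obtain S where S: "finite S" "maximal S (\<lambda>T. T \<subseteq> set (cols A) \<and> lin_indpt T)"
  proof -
    have "lin_indpt {}"
      by (simp add: lin_dep_def)
    then show ?thesis
      using maximal_exists_superset[of "set (cols A)" "\<lambda>T. T \<subseteq> set (cols A) \<and> lin_indpt T" "{}"] that
      by auto
  qed
  have SA: "S \<subseteq> set (cols A)" and indS: "lin_indpt S"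
    using S(2) by (auto simp: maximal_def)
  have SC: "S \<subseteq> carrier_vec nr"
    using SA colsA by blast
  have span: "c \<in> span S" if c: "c \<in> set (cols A)" for c
  proof (cases "c \<in> S")
    case True
    then show ?thesis using SC by (simp add: span_mem)
  next
    case False
    \<comment> \<open>A column outside the span could be added to \<open>S\<close>, against
      maximality.\<close>
    have "\<not> lin_indpt (S \<union> {c})"
    proof
      assume "lin_indpt (S \<union> {c})"
      then have "S \<union> {c} = S"
        using S(2) c SA unfolding maximal_def by blast
      then show False using False by blast
    qed
    then show ?thesis
      using lin_dep_iff_in_span[of S c] SC indS False c colsA by auto
  qed
  have "\<exists>a. c = lincomb a S" if c: "c \<in> set (cols A)" for c
    using finite_in_span[OF S(1) SC] span[OF c] by auto
  then obtain a where a: "\<And>c. c \<in> set (cols A) \<Longrightarrow> c = lincomb (a c) S"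
    by metis
  have "A $$ (i, j) = (\<Sum>x\<in>S. x $ i * a (col A j) x)" if "i < nr" "j < nc" for i j
  proof -
    have "col A j \<in> set (cols A)"
      using that A by (metis carrier_matD(2) cols_length cols_nth nth_mem)
    then have "col A j $ i = lincomb (a (col A j)) S $ i"
      using a by metis
    also have "\<dots> = (\<Sum>x\<in>S. a (col A j) x * x $ i)"
      using lincomb_index[OF that(1) SC] by simp
    finally show ?thesis
      using that A by (simp add: mult.commute)
  qed
  moreover have "card S = rank A"
    using rank_card_indpt[OF A S(2)] by simp
  ultimately show ?thesis
    using S(1) by (intro exI[of _ S] exI[of _ "\<lambda>x j. a (col A j) x"]) auto
qed

lemma mat_rank_le_min_dim: "mat_rank A \<le> min_dim A"
proof -
  \<comment> \<open>For the bound by the number of rows, the matrix is the sum over \<open>l\<close>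
    of the unit vector \<open>l\<close> times row \<open>l\<close>.\<close>
  have "mat_rank A \<le> card {..<dim_row A}"
    by (rule rank_le_card_sum_products[where nc = "dim_col A"
          and f = "\<lambda>l i. of_bool (i = l)" and g = "\<lambda>l j. A $$ (l, j)"])
      (simp_all add: of_bool_def if_distrib[of "\<lambda>x. x * _"] cong: if_cong)
  moreover have "mat_rank A \<le> dim_col A"
    by (rule vec_space.rank_le_nc) auto
  ultimately show ?thesis by simp
qed

section \<open>Kronecker products\<close>

lemma dim_kronecker [simp]:
  "dim_row (X \<otimes>\<^sub>K Y) = dim_row X * dim_row Y" "dim_col (X \<otimes>\<^sub>K Y) = dim_col X * dim_col Y"
  by (simp_all add: kronecker_def)

lemma div_mod_less_mult:
  fixes i p q :: nat
  assumes "i < p * q"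
  shows "i div q < p" "i mod q < q"
proof -
  have "q > 0" using assms by (cases q) auto
  then show "i mod q < q" by simp
  show "i div q < p" using assms by (rule less_mult_imp_div_less)
qed

lemma index_kronecker:
  assumes "i < dim_row X * dim_row Y" "j < dim_col X * dim_col Y"
  shows "(X \<otimes>\<^sub>K Y) $$ (i, j) =
    X $$ (i div dim_row Y, j div dim_col Y) * Y $$ (i mod dim_row Y, j mod dim_col Y)"
  using assms by (simp add: kronecker_def)

text \<open>Multiplying rank factorizations of the two factors yields one of the Kronecker product,
  with pairs from \<open>S \<times> T\<close> as summation index.\<close>

lemma mat_rank_kronecker_le: "mat_rank (X \<otimes>\<^sub>K Y) \<le> mat_rank X * mat_rank Y"
proof -
  obtain S g where S: "finite S" "card S = mat_rank X"
    "\<And>i j. i < dim_row X \<Longrightarrow> j < dim_col X \<Longrightarrow> X $$ (i, j) = (\<Sum>x\<in>S. x $ i * g x j)"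
    using rank_factorization[of X "dim_row X" "dim_col X"] by auto
  obtain T h where T: "finite T" "card T = mat_rank Y"
    "\<And>i j. i < dim_row Y \<Longrightarrow> j < dim_col Y \<Longrightarrow> Y $$ (i, j) = (\<Sum>y\<in>T. y $ i * h y j)"
    using rank_factorization[of Y "dim_row Y" "dim_col Y"] by auto
  have "mat_rank (X \<otimes>\<^sub>K Y) \<le> card (S \<times> T)"
  proof (rule rank_le_card_sum_products[where nc = "dim_col (X \<otimes>\<^sub>K Y)"
        and f = "\<lambda>(x, y) i. x $ (i div dim_row Y) * y $ (i mod dim_row Y)"
        and g = "\<lambda>(x, y) j. g x (j div dim_col Y) * h y (j mod dim_col Y)"])
    fix i j assume ij: "i < dim_row (X \<otimes>\<^sub>K Y)" "j < dim_col (X \<otimes>\<^sub>K Y)"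
    then show "(X \<otimes>\<^sub>K Y) $$ (i, j) =
      (\<Sum>l\<in>S \<times> T. (case l of (x, y) \<Rightarrow> \<lambda>i. x $ (i div dim_row Y) * y $ (i mod dim_row Y)) i *
        (case l of (x, y) \<Rightarrow> \<lambda>j. g x (j div dim_col Y) * h y (j mod dim_col Y)) j)"
      by (simp add: index_kronecker S(3) T(3) div_mod_less_mult sum_product sum.cartesian_product
          case_prod_unfold mult_ac)
  qed (use S T in auto)
  then show ?thesis
    by (simp add: card_cartesian_product S T)
qed

section \<open>Spectral norm\<close>

lemma vec_norm2_nonneg [simp]: "0 \<le> vec_norm2 v"
  by (simp add: vec_norm2_def)

lemma vec_norm2_square: "(vec_norm2 v)\<^sup>2 = (\<Sum>i<dim_vec v. (cmod (v $ i))\<^sup>2)"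
  by (simp add: vec_norm2_def L2_set_def sum_nonneg)

lemma vec_norm2_smult: "vec_norm2 (c \<cdot>\<^sub>v v) = cmod c * vec_norm2 v"
  by (simp add: vec_norm2_def L2_set_right_distrib norm_mult cong: L2_set_cong_simp)

lemma vec_norm2_add_le:
  assumes "u \<in> carrier_vec n" "v \<in> carrier_vec n"
  shows "vec_norm2 (u + v) \<le> vec_norm2 u + vec_norm2 v"
proof -
  have "vec_norm2 (u + v) \<le> L2_set (\<lambda>i. cmod (u $ i) + cmod (v $ i)) {..<n}"
    unfolding vec_norm2_def using assms by (auto intro!: L2_set_mono norm_triangle_ineq)
  also have "\<dots> \<le> vec_norm2 u + vec_norm2 v"
    using L2_set_triangle_ineq[of "\<lambda>i. cmod (u $ i)" "\<lambda>i. cmod (v $ i)" "{..<n}"] assms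
    by (simp add: vec_norm2_def)
  finally show ?thesis .
qed

lemma index_mult_mat_vec_sum:
  assumes "i < dim_row A" "x \<in> carrier_vec (dim_col A)"
  shows "(A *\<^sub>v x) $ i = (\<Sum>j<dim_col A. A $$ (i, j) * x $ j)"
  using assms by (auto simp: scalar_prod_def lessThan_atLeast0)

text \<open>A crude bound, wanted only because the supremum defining \<open>spectral_norm\<close>
  must range over a set that is bounded above.\<close>

lemma vec_norm2_mult_mat_vec_le_sum:
  assumes x: "x \<in> carrier_vec (dim_col A)" "vec_norm2 x \<le> 1"
  shows "vec_norm2 (A *\<^sub>v x) \<le> (\<Sum>i<dim_row A. \<Sum>j<dim_col A. cmod (A $$ (i, j)))"
proof -
  have le1: "cmod (x $ j) \<le> 1" if "j < dim_col A" for j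
    using member_le_L2_set[of "{..<dim_vec x}" j "\<lambda>j. cmod (x $ j)"] that x
    by (auto simp: vec_norm2_def)
  have "vec_norm2 (A *\<^sub>v x) \<le> (\<Sum>i<dim_row A. cmod ((A *\<^sub>v x) $ i))"
    
    using L2_set_le_sum[of "{..<dim_row A}" "\<lambda>i. cmod ((A *\<^sub>v x) $ i)"]
    by (simp add: vec_norm2_def del: index_mult_mat_vec)
  also have "\<dots> \<le> (\<Sum>i<dim_row A. \<Sum>j<dim_col A. cmod (A $$ (i, j)))"
  proof (rule sum_mono)
    fix i assume i: "i \<in> {..<dim_row A}"
    have "cmod ((A *\<^sub>v x) $ i) \<le> (\<Sum>j<dim_col A. cmod (A $$ (i, j) * x $ j))"
      using i x by (simp add: index_mult_mat_vec_sum norm_sum del: index_mult_mat_vec)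
    also have "\<dots> \<le> (\<Sum>j<dim_col A. cmod (A $$ (i, j)))"
      using le1 by (intro sum_mono) (simp add: norm_mult mult_left_le)
    finally show "cmod ((A *\<^sub>v x) $ i) \<le> (\<Sum>j<dim_col A. cmod (A $$ (i, j)))" .
  qed
  finally show ?thesis .
qed

lemma spectral_norm_nonneg: "0 \<le> spectral_norm A"
  and vec_norm2_mult_mat_vec_le:
    "x \<in> carrier_vec (dim_col A) \<Longrightarrow> vec_norm2 (A *\<^sub>v x) \<le> spectral_norm A * vec_norm2 x"
proof -
  let ?U = "{vec_norm2 (A *\<^sub>v x) | x. x \<in> carrier_vec (dim_col A) \<and> vec_norm2 x \<le> 1}"
  have bdd: "bdd_above ?U"
    by (rule bdd_aboveI[where M = "\<Sum>i<dim_row A. \<Sum>j<dim_col A. cmod (A $$ (i, j))"])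
      (use vec_norm2_mult_mat_vec_le_sum in blast)
  have unit: "vec_norm2 (A *\<^sub>v x) \<le> spectral_norm A"
    if "x \<in> carrier_vec (dim_col A)" "vec_norm2 x \<le> 1" for x
    unfolding spectral_norm_def using that by (intro cSup_upper bdd) auto
  have "vec_norm2 (0\<^sub>v (dim_col A)) = 0"
    by (simp add: vec_norm2_def L2_set_0')
  then show nonneg: "0 \<le> spectral_norm A"
    by (intro order.trans[OF vec_norm2_nonneg unit[of "0\<^sub>v (dim_col A)"]]) auto
  show "vec_norm2 (A *\<^sub>v x) \<le> spectral_norm A * vec_norm2 x" if x: "x \<in> carrier_vec (dim_col A)"
  proof (cases "vec_norm2 x = 0")
    case True
    then have "x = 0\<^sub>v (dim_col A)"
      using x by (intro eq_vecI) (auto simp: vec_norm2_def L2_set_eq_0_iff)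
    then have "A *\<^sub>v x = 0\<^sub>v (dim_row A)"
      by auto
    then show ?thesis
      using True by (simp add: vec_norm2_def L2_set_0')
  next
    case False
    let ?c = "vec_norm2 x"
    have c: "?c > 0" using False vec_norm2_nonneg[of x] by linarith
    \<comment> \<open>Rescaling a nonzero vector to norm 1 reduces the claim to the unit
      ball.\<close>
    have "vec_norm2 (A *\<^sub>v (complex_of_real (1 / ?c) \<cdot>\<^sub>v x)) \<le> spectral_norm A"
      using c x by (intro unit) (auto simp: vec_norm2_smult norm_divide simp del: of_real_divide)
    then have "vec_norm2 (A *\<^sub>v x) / ?c \<le> spectral_norm A"
      using c x mult_mat_vec[of A "dim_row A" "dim_col A" x]
      by (auto simp: vec_norm2_smult norm_divide)
    then show ?thesis
      using c by (simp add: field_simps)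
  qed
qed

lemma spectral_norm_le:
  assumes "0 \<le> a"
    and "\<And>x. x \<in> carrier_vec (dim_col A) \<Longrightarrow> vec_norm2 (A *\<^sub>v x) \<le> a * vec_norm2 x"
  shows "spectral_norm A \<le> a"
  unfolding spectral_norm_def
proof (rule cSup_least)
  have "vec_norm2 (0\<^sub>v (dim_col A)) \<le> 1"
    by (simp add: vec_norm2_def L2_set_0')
  then show "{vec_norm2 (A *\<^sub>v x) | x. x \<in> carrier_vec (dim_col A) \<and> vec_norm2 x \<le> 1} \<noteq> {}"
    using zero_carrier_vec by blast
next
  fix y assume "y \<in> {vec_norm2 (A *\<^sub>v x) | x. x \<in> carrier_vec (dim_col A) \<and> vec_norm2 x \<le> 1}"
  then obtain x where "y = vec_norm2 (A *\<^sub>v x)" "x \<in> carrier_vec (dim_col A)" "vec_norm2 x \<le> 1"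
    by blast
  then show "y \<le> a"
    using assms(2)[of x] mult_left_le[of "vec_norm2 x" a] assms(1) by linarith
qed

lemma spectral_norm_add_le:
  assumes "A \<in> carrier_mat nr nc" "B \<in> carrier_mat nr nc"
  shows "spectral_norm (A + B) \<le> spectral_norm A + spectral_norm B"
proof (rule spectral_norm_le)
  fix x :: "complex vec" assume "x \<in> carrier_vec (dim_col (A + B))"
  then have x: "x \<in> carrier_vec nc" using assms by simp
  have "vec_norm2 ((A + B) *\<^sub>v x) \<le> vec_norm2 (A *\<^sub>v x) + vec_norm2 (B *\<^sub>v x)"
    using assms x by (simp add: add_mult_distrib_mat_vec[of A nr nc] vec_norm2_add_le[where n = nr])
  also have "\<dots> \<le> (spectral_norm A + spectral_norm B) * vec_norm2 x"
    using vec_norm2_mult_mat_vec_le[of x A] vec_norm2_mult_mat_vec_le[of x B] assms x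
    by (simp add: distrib_right)
  finally show "vec_norm2 ((A + B) *\<^sub>v x) \<le> (spectral_norm A + spectral_norm B) * vec_norm2 x" .
qed (simp add: spectral_norm_nonneg)

text \<open>The operator norm inequality in coordinates, for vectors given as functions. In this
  form it applies directly to the slices of a doubly indexed array.\<close>

lemma sum_cmod_square_le_spectral_norm:
  "(\<Sum>i<dim_row A. (cmod (\<Sum>j<dim_col A. A $$ (i, j) * f j))\<^sup>2)
    \<le> (spectral_norm A)\<^sup>2 * (\<Sum>j<dim_col A. (cmod (f j))\<^sup>2)"
proof -
  let ?x = "vec (dim_col A) f"
  have "(vec_norm2 (A *\<^sub>v ?x))\<^sup>2 \<le> (spectral_norm A * vec_norm2 ?x)\<^sup>2"
    by (intro power_mono vec_norm2_mult_mat_vec_le) auto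
  then show ?thesis
    by (simp add: vec_norm2_square power_mult_distrib index_mult_mat_vec_sum
        del: index_mult_mat_vec)
qed

text \<open>Row and column indices of a Kronecker product encode pairs by \<open>div\<close> and
  \<open>mod\<close>; this turns a sum over such indices into a double sum over the pairs.\<close>

lemma sum_lessThan_mult_div_mod:
  "(\<Sum>k<p * q. F (k div q) (k mod q)) = (\<Sum>i<p. \<Sum>j<q. F i j)"
  for p q :: nat and F :: "nat \<Rightarrow> nat \<Rightarrow> 'a :: comm_monoid_add"
proof (induction p)
  case (Suc p)
  have "(\<Sum>k<Suc p * q. F (k div q) (k mod q)) =
    (\<Sum>k<p * q. F (k div q) (k mod q)) + (\<Sum>k=p * q..<p * q + q. F (k div q) (k mod q))"
    using sum.atLeastLessThan_concat[of 0 "p * q" "p * q + q" "\<lambda>k. F (k div q) (k mod q)"]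
    by (simp add: lessThan_atLeast0 add.commute)
  also have "(\<Sum>k=p * q..<p * q + q. F (k div q) (k mod q)) =
    (\<Sum>j<q. F ((j + p * q) div q) ((j + p * q) mod q))"
    using sum.shift_bounds_nat_ivl[of "\<lambda>k. F (k div q) (k mod q)" 0 "p * q" q]
    by (simp add: lessThan_atLeast0 add.commute)
  also have "\<dots> = (\<Sum>j<q. F p j)"
    by (intro sum.cong) auto
  finally show ?case
    using Suc by simp
qed simp

text \<open>The Kronecker product acts on a vector in two stages: \<open>Y\<close> is applied inside
  every block, and then \<open>X\<close> mixes the blocks at each fixed inner position. Each stage
  costs one factor of the bound.\<close>

lemma spectral_norm_kronecker_le:
  "spectral_norm (X \<otimes>\<^sub>K Y) \<le> spectral_norm X * spectral_norm Y"
proof (rule spectral_norm_le)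
  fix x :: "complex vec" assume xc: "x \<in> carrier_vec (dim_col (X \<otimes>\<^sub>K Y))"
  then have x: "dim_vec x = dim_col X * dim_col Y" by auto
  \<comment> \<open>Here \<open>z j l\<close> is entry \<open>l\<close> of block \<open>j\<close> of
    the vector, and \<open>w k j\<close> is entry \<open>k\<close> of \<open>Y\<close> applied to
    that block.\<close>
  define z where "z j l = x $ (j * dim_col Y + l)" for j l
  define w where "w k j = (\<Sum>l<dim_col Y. Y $$ (k, l) * z j l)" for k j
  have entry: "((X \<otimes>\<^sub>K Y) *\<^sub>v x) $ r =
      (\<Sum>j<dim_col X. X $$ (r div dim_row Y, j) * w (r mod dim_row Y) j)"
    if "r < dim_row X * dim_row Y" for r
  proof -
    have "((X \<otimes>\<^sub>K Y) *\<^sub>v x) $ r = (\<Sum>s<dim_col X * dim_col Y.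
        X $$ (r div dim_row Y, s div dim_col Y) * Y $$ (r mod dim_row Y, s mod dim_col Y) *
        z (s div dim_col Y) (s mod dim_col Y))"
      unfolding index_mult_mat_vec_sum[OF that[folded dim_kronecker] xc] dim_kronecker
      using that by (intro sum.cong refl) (simp add: index_kronecker z_def)
    also have "\<dots> = (\<Sum>j<dim_col X. \<Sum>l<dim_col Y.
        X $$ (r div dim_row Y, j) * Y $$ (r mod dim_row Y, l) * z j l)"
      by (rule sum_lessThan_mult_div_mod)
    finally show ?thesis
      by (simp add: w_def sum_distrib_left mult_ac)
  qed
  have "(vec_norm2 ((X \<otimes>\<^sub>K Y) *\<^sub>v x))\<^sup>2 = (\<Sum>r<dim_row X * dim_row Y.
      (cmod (\<Sum>j<dim_col X. X $$ (r div dim_row Y, j) * w (r mod dim_row Y) j))\<^sup>2)"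
    using entry by (simp add: vec_norm2_square del: index_mult_mat_vec)
  also have "\<dots> = (\<Sum>i<dim_row X. \<Sum>k<dim_row Y. (cmod (\<Sum>j<dim_col X. X $$ (i, j) * w k j))\<^sup>2)"
    by (rule sum_lessThan_mult_div_mod)
  \<comment> \<open>With \<open>k\<close> outermost, the inner sum is the squared norm of
    \<open>X\<close> applied to the vector \<open>w k\<close>. A second exchange below puts
    \<open>j\<close> outermost, so that the bound for \<open>Y\<close> applies to block
    \<open>j\<close>.\<close>
  also have "\<dots> = (\<Sum>k<dim_row Y. \<Sum>i<dim_row X. (cmod (\<Sum>j<dim_col X. X $$ (i, j) * w k j))\<^sup>2)"
    by (rule sum.swap)
  also have "\<dots> \<le> (\<Sum>k<dim_row Y. (spectral_norm X)\<^sup>2 * (\<Sum>j<dim_col X. (cmod (w k j))\<^sup>2))"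
    by (intro sum_mono sum_cmod_square_le_spectral_norm)
  also have "\<dots> = (spectral_norm X)\<^sup>2 * (\<Sum>j<dim_col X. \<Sum>k<dim_row Y. (cmod (w k j))\<^sup>2)"
    by (subst sum.swap) (simp add: sum_distrib_left)
  also have "\<dots> \<le> (spectral_norm X)\<^sup>2 *
      (\<Sum>j<dim_col X. (spectral_norm Y)\<^sup>2 * (\<Sum>l<dim_col Y. (cmod (z j l))\<^sup>2))"
    unfolding w_def by (intro mult_left_mono sum_mono sum_cmod_square_le_spectral_norm) simp
  also have "\<dots> = (spectral_norm X)\<^sup>2 * (spectral_norm Y)\<^sup>2 *
      (\<Sum>j<dim_col X. \<Sum>l<dim_col Y. (cmod (z j l))\<^sup>2)"
    by (simp add: sum_distrib_left mult.assoc)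
  also have "(\<Sum>j<dim_col X. \<Sum>l<dim_col Y. (cmod (z j l))\<^sup>2) = (vec_norm2 x)\<^sup>2"
    using sum_lessThan_mult_div_mod[of "\<lambda>j l. (cmod (z j l))\<^sup>2" "dim_col Y" "dim_col X"]
    by (simp add: vec_norm2_square x z_def)
  finally have "(vec_norm2 ((X \<otimes>\<^sub>K Y) *\<^sub>v x))\<^sup>2 \<le> (spectral_norm X * spectral_norm Y * vec_norm2 x)\<^sup>2"
    by (simp add: power_mult_distrib)
  then show "vec_norm2 ((X \<otimes>\<^sub>K Y) *\<^sub>v x) \<le> spectral_norm X * spectral_norm Y * vec_norm2 x"
    by (rule power2_le_imp_le) (simp add: spectral_norm_nonneg)
qed (simp add: spectral_norm_nonneg)

section \<open>Unitary diagonalization and singular values\<close>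

lemma dim_mat_adjoint [simp]:
  "dim_row (mat_adjoint A) = dim_col A" "dim_col (mat_adjoint A) = dim_row A"
  by (simp_all add: mat_adjoint_def)

lemma mat_adjoint_carrier:
  "A \<in> carrier_mat nr nc \<Longrightarrow> mat_adjoint A \<in> carrier_mat nc nr"
  by auto

lemma index_mat_adjoint:
  "i < dim_col A \<Longrightarrow> j < dim_row A \<Longrightarrow> mat_adjoint A $$ (i, j) = conjugate (A $$ (j, i))"
  by (simp add: mat_adjoint_def mat_of_rows_index)

lemma index_mult_mat_sum:
  "i < dim_row A \<Longrightarrow> j < dim_col B \<Longrightarrow> dim_col A = dim_row B \<Longrightarrow>
    (A * B) $$ (i, j) = (\<Sum>k<dim_col A. A $$ (i, k) * B $$ (k, j))"
  by (simp add: scalar_prod_def lessThan_atLeast0)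

lemma mat_adjoint_mult:
  fixes A B :: "complex mat"
  assumes "dim_col A = dim_row B"
  shows "mat_adjoint (A * B) = mat_adjoint B * mat_adjoint A"
  using assms
  by (intro eq_matI)
    (simp_all add: index_mat_adjoint index_mult_mat_sum cnj_sum mult.commute del: index_mult_mat(1))

lemma mat_adjoint_mat_adjoint [simp]: "mat_adjoint (mat_adjoint A) = (A :: complex mat)"
  by (intro eq_matI) (simp_all add: index_mat_adjoint)

lemma vec_norm2_eq_scalar_prod: "complex_of_real ((vec_norm2 v)\<^sup>2) = v \<bullet>c v"
  by (simp add: vec_norm2_square scalar_prod_def lessThan_atLeast0 complex_norm_square
      del: of_real_power)

text \<open>The inner products of the columns are the entries of the Gram matrix, so orthogonality
  kills those off the diagonal and the normalization makes the others 1. Dividing is safe because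
  \<open>corthogonal\<close> also excludes vectors whose inner product with themselves is 0.\<close>

lemma corthogonal_normalize:
  fixes ws :: "complex vec list"
  assumes ws: "set ws \<subseteq> carrier_vec n" "corthogonal ws" "length ws = n"
  defines "W \<equiv> mat_of_cols n (map (\<lambda>w. complex_of_real (1 / vec_norm2 w) \<cdot>\<^sub>v w) ws)"
  shows "W \<in> carrier_mat n n" "mat_adjoint W * W = 1\<^sub>m n"
proof -
  show W: "W \<in> carrier_mat n n"
    unfolding W_def using ws(3) by auto
  have dimws: "dim_vec (ws ! i) = n" if "i < n" for i
    using that ws(1,3) by (metis carrier_vecD nth_mem subsetD)
  have entry: "W $$ (k, i) = ws ! i $ k / vec_norm2 (ws ! i)" if "k < n" "i < n" for k i
    using that ws(3) dimws[of i] by (simp add: W_def mat_of_cols_index)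
  show "mat_adjoint W * W = 1\<^sub>m n"
  proof (rule eq_matI)
    fix i j assume "i < dim_row (1\<^sub>m n :: complex mat)" "j < dim_col (1\<^sub>m n :: complex mat)"
    then have ij: "i < n" "j < n" by auto
    have "(mat_adjoint W * W) $$ (i, j) = (\<Sum>k<n. cnj (W $$ (k, i)) * W $$ (k, j))"
      using W ij by (subst index_mult_mat_sum) (auto simp: index_mat_adjoint)
    also have "\<dots> = (\<Sum>k<n. ws ! j $ k * cnj (ws ! i $ k)) / (vec_norm2 (ws ! i) * vec_norm2 (ws ! j))"
      using ij by (simp add: entry sum_divide_distrib mult.commute)
    also have "(\<Sum>k<n. ws ! j $ k * cnj (ws ! i $ k)) = ws ! j \<bullet>c ws ! i"
      using dimws[OF ij(1)] by (simp add: scalar_prod_def lessThan_atLeast0)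
    also have "ws ! j \<bullet>c ws ! i / (vec_norm2 (ws ! i) * vec_norm2 (ws ! j)) = 1\<^sub>m n $$ (i, j)"
    proof (cases "i = j")
      case True
      have "ws ! i \<bullet>c ws ! i \<noteq> 0"
        using corthogonalD[OF ws(2), of i i] ij ws(3) by simp
      then show ?thesis
        using True ij by (simp flip: vec_norm2_eq_scalar_prod add: power2_eq_square)
    next
      case False
      then show ?thesis
        using corthogonalD[OF ws(2), of j i] ij ws(3) by simp
    qed
    finally show "(mat_adjoint W * W) $$ (i, j) = 1\<^sub>m n $$ (i, j)" .
  qed (use W in auto)
qed

text \<open>Complete \<open>v\<close> to a basis and orthogonalize: Gram-Schmidt keeps its first
  vector, and normalization only rescales it. The scalar \<open>c\<close> is left open since any
  multiple of an eigenvector serves the deflation below.\<close>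

lemma unitary_with_first_column:
  fixes v :: "complex vec"
  assumes v: "v \<in> carrier_vec n" "v \<noteq> 0\<^sub>v n"
  shows "\<exists>W c. W \<in> carrier_mat n n \<and> mat_adjoint W * W = 1\<^sub>m n \<and> col W 0 = c \<cdot>\<^sub>v v"
proof -
  interpret cof_vec_space n "TYPE(complex)" .
  have "n \<noteq> 0"
    using v by (metis eq_vecI carrier_vecD index_zero_vec(2) less_nat_zero_code)
  define b where "b = basis_completion v"
  define ws where "ws = gram_schmidt n b"
  define W where "W = mat_of_cols n (map (\<lambda>w. complex_of_real (1 / vec_norm2 w) \<cdot>\<^sub>v w) ws)"
  note b = basis_completion[OF v, folded b_def]
  obtain vs where bv: "b = v # vs"
    using b \<open>n \<noteq> 0\<close> by (cases b) auto
  have "\<not> lin_dep (set b)" "set b \<subseteq> carrier_vec n" "distinct b" "length b = n"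
    using b by auto
  then have ws: "set ws \<subseteq> carrier_vec n" "corthogonal ws" "length ws = n"
    using gram_schmidt_result[of b ws] ws_def by auto
  have "hd ws = v"
    unfolding ws_def bv using v by simp
  then have "ws ! 0 = v"
    using ws(3) \<open>n \<noteq> 0\<close> by (metis hd_conv_nth list.size(3))
  then have "col W 0 = complex_of_real (1 / vec_norm2 v) \<cdot>\<^sub>v v"
    unfolding W_def using ws \<open>n \<noteq> 0\<close> v by (subst col_mat_of_cols) auto
  then show ?thesis
    using corthogonal_normalize[OF ws, folded W_def] by blast
qed

section \<open>The spectral theorem for Hermitian matrices\<close>

lemma mult_block_diag:
  fixes A B C D :: "'a :: semiring_1 mat"
  assumes "A \<in> carrier_mat a a" "B \<in> carrier_mat b b" "C \<in> carrier_mat a a" "D \<in> carrier_mat b b"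
  shows "four_block_mat A (0\<^sub>m a b) (0\<^sub>m b a) B * four_block_mat C (0\<^sub>m a b) (0\<^sub>m b a) D =
    four_block_mat (A * C) (0\<^sub>m a b) (0\<^sub>m b a) (B * D)"
  using assms by (subst mult_four_block_mat[of _ a a _ b _ b _ _ a _ b]) auto

text \<open>Deflation by induction on the list of eigenvalues. Conjugating with a unitary matrix
  whose first column is an eigenvector for \<open>e\<close> clears the first column and, by
  Hermitian symmetry, the first row. The remaining block is Hermitian with the other eigenvalues.
  The diagonal follows the order of \<open>es\<close>, so positions in the list can be used as
  column indices later.\<close>

lemma hermitian_unitary_diagonalization:
  fixes H :: "complex mat"
  assumes "H \<in> carrier_mat n n" and "mat_adjoint H = H"
    and "char_poly H = (\<Prod>e\<leftarrow>es. [:- e, 1:])"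
  shows "\<exists>U \<in> carrier_mat n n. mat_adjoint U * U = 1\<^sub>m n \<and>
    mat_adjoint U * H * U = mat n n (\<lambda>(i, j). if i = j then es ! i else 0)"
  using assms
proof (induction es arbitrary: n H)
  case Nil
  then have "n = 0"
    using degree_monic_char_poly[of H n] by simp
  then show ?case
    using Nil by (intro bexI[of _ "1\<^sub>m 0"] conjI eq_matI) auto
next
  case (Cons e es n H)
  note H = Cons.prems(1) and herm = Cons.prems(2)
  have cp: "char_poly H = [:- e, 1:] * (\<Prod>e\<leftarrow>es. [:- e, 1:])"
    using Cons.prems(3) by simp
  have "eigenvalue H e"
    unfolding eigenvalue_root_char_poly[OF H] cp by simp
  then obtain v where v: "v \<in> carrier_vec n" "v \<noteq> 0\<^sub>v n" "H *\<^sub>v v = e \<cdot>\<^sub>v v"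
    using H unfolding eigenvalue_def eigenvector_def by auto
  then obtain n1 where n: "n = Suc n1"
    by (metis carrier_vecD eq_vecI index_zero_vec(2) less_nat_zero_code not0_implies_Suc)
  obtain W c where W: "W \<in> carrier_mat n n" and WW: "mat_adjoint W * W = 1\<^sub>m n"
    and col0: "col W 0 = c \<cdot>\<^sub>v v"
    using unitary_with_first_column[OF v(1,2)] by blast
  have W': "mat_adjoint W \<in> carrier_mat n n"
    using W by (rule mat_adjoint_carrier)
  have WW': "W * mat_adjoint W = 1\<^sub>m n"
    by (rule mat_mult_left_right_inverse[OF W' W WW])
  define G where "G = mat_adjoint W * H * W"
  have G: "G \<in> carrier_mat n n"
    unfolding G_def using W W' H by auto
  have G_assoc: "G = mat_adjoint W * (H * W)"
    unfolding G_def using W W' H by (simp add: assoc_mult_mat[of _ n n _ n _ n])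
  have G_herm: "mat_adjoint G = G"
    using W W' H herm unfolding G_assoc
    by (subst mat_adjoint_mult, simp, subst mat_adjoint_mult)
      (auto simp: assoc_mult_mat[of _ n n _ n _ n])
  have G_sym: "G $$ (i, j) = cnj (G $$ (j, i))" if "i < n" "j < n" for i j
    using arg_cong[OF G_herm, of "\<lambda>X. X $$ (i, j)"] that G by (simp add: index_mat_adjoint)
  \<comment> \<open>Since \<open>H\<close> maps column 0 of \<open>W\<close> to \<open>e\<close>
    times itself, column 0 of \<open>G\<close> is \<open>e\<close> times column 0 of
    \<open>mat_adjoint W * W\<close>, the identity.\<close>
  have G_col0: "G $$ (i, 0) = (if i = 0 then e else 0)" if "i < n" for i
  proof -
    have "col (H * W) 0 = H *\<^sub>v col W 0"
      using H W n by (intro col_mult2) auto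
    also have "\<dots> = e \<cdot>\<^sub>v col W 0"
      using H v by (simp add: col0 mult_mat_vec[of H n n] smult_smult_assoc mult.commute)
    finally have "G $$ (i, 0) = row (mat_adjoint W) i \<bullet> (e \<cdot>\<^sub>v col W 0)"
      unfolding G_assoc using that H W n by (subst index_mult_mat(1)) auto
    also have "\<dots> = e * (row (mat_adjoint W) i \<bullet> col W 0)"
      using W that n by (intro scalar_prod_smult_distrib[of _ n] carrier_vecI) simp_all
    also have "row (mat_adjoint W) i \<bullet> col W 0 = (mat_adjoint W * W) $$ (i, 0)"
      using W that n by simp
    also have "\<dots> = (if i = 0 then 1 else 0)"
      unfolding WW using that n by simp
    finally show ?thesis by simp
  qed
  have G_row0: "G $$ (0, j) = (if j = 0 then e else 0)" if "j < n" for j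
    using G_sym[of 0 j] G_col0[OF that] G_col0[of 0] that n by (auto split: if_splits)
  define K where "K = mat n1 n1 (\<lambda>(i, j). G $$ (Suc i, Suc j))"
  define E where "E = mat 1 1 (\<lambda>_. e)"
  have K: "K \<in> carrier_mat n1 n1" and E: "E \<in> carrier_mat 1 1"
    unfolding K_def E_def by auto
  have G_block: "G = four_block_mat E (0\<^sub>m 1 n1) (0\<^sub>m n1 1) K"
  proof (rule eq_matI)
    fix i j
    assume "i < dim_row (four_block_mat E (0\<^sub>m 1 n1) (0\<^sub>m n1 1) K)"
      and "j < dim_col (four_block_mat E (0\<^sub>m 1 n1) (0\<^sub>m n1 1) K)"
    then have "i < n" "j < n" using E K n by auto
    then show "G $$ (i, j) = four_block_mat E (0\<^sub>m 1 n1) (0\<^sub>m n1 1) K $$ (i, j)"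
      using E K n G_col0[of i] G_row0[of j] by (cases i; cases j) (auto simp: E_def K_def)
  qed (use G E K n in auto)
  have "similar_mat_wit G H (mat_adjoint W) W"
    by (rule similar_mat_witI[of _ _ n]) (use W W' H G WW WW' G_def in auto)
  then have "char_poly G = char_poly H"
    by (intro char_poly_similar) (auto simp: similar_mat_def)
  moreover have "char_poly G = char_poly E * char_poly K"
    unfolding G_block by (rule char_poly_four_block_zeros_col[OF E _ K]) simp
  moreover have "char_poly E = [:- e, 1:]"
    by (simp add: E_def char_poly_defs det_def sign_def)
  \<comment> \<open>Cancelling the nonzero factor \<open>[:- e, 1:]\<close> leaves the
    characteristic polynomial of \<open>K\<close> split over \<open>es\<close>, as the induction
    hypothesis requires.\<close>
  ultimately have "[:- e, 1:] * char_poly K = [:- e, 1:] * (\<Prod>e\<leftarrow>es. [:- e, 1:])"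
    using cp by simp
  then have cpK: "char_poly K = (\<Prod>e\<leftarrow>es. [:- e, 1:])"
    by (metis mult_cancel_left pCons_eq_0_iff zero_neq_one)
  have "mat_adjoint K = K"
  proof (rule eq_matI)
    fix i j assume "i < dim_row K" "j < dim_col K"
    then show "mat_adjoint K $$ (i, j) = K $$ (i, j)"
      using K G_sym[of "Suc i" "Suc j"] n by (simp add: index_mat_adjoint) (simp add: K_def)
  qed (use K in auto)
  from Cons.IH[OF K this cpK] obtain V where V: "V \<in> carrier_mat n1 n1"
    and VV: "mat_adjoint V * V = 1\<^sub>m n1"
    and VKV: "mat_adjoint V * K * V = mat n1 n1 (\<lambda>(i, j). if i = j then es ! i else 0)"
    by blast
  have V': "mat_adjoint V \<in> carrier_mat n1 n1"
    using V by (rule mat_adjoint_carrier)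
  \<comment> \<open>Padding \<open>V\<close> with a leading 1 lets it diagonalize \<open>K\<close>
    without disturbing the entry \<open>e\<close> already split off.\<close>
  define F where "F = four_block_mat (1\<^sub>m 1) (0\<^sub>m 1 n1) (0\<^sub>m n1 1) V"
  have F: "F \<in> carrier_mat n n"
    unfolding F_def n using V by (metis four_block_carrier_mat one_carrier_mat plus_1_eq_Suc)
  have F': "mat_adjoint F \<in> carrier_mat n n"
    using F by (rule mat_adjoint_carrier)
  have F_adj: "mat_adjoint F = four_block_mat (1\<^sub>m 1) (0\<^sub>m 1 n1) (0\<^sub>m n1 1) (mat_adjoint V)"
    unfolding F_def using V by (intro eq_matI) (auto simp: index_mat_adjoint)
  have FF: "mat_adjoint F * F = 1\<^sub>m n"
    unfolding F_adj unfolding F_def n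
    by (subst mult_block_diag[OF one_carrier_mat V' one_carrier_mat V]) (simp add: VV)
  have V'K: "mat_adjoint V * K \<in> carrier_mat n1 n1"
    by (rule mult_carrier_mat[OF V' K])
  have F'G: "mat_adjoint F * G = four_block_mat E (0\<^sub>m 1 n1) (0\<^sub>m n1 1) (mat_adjoint V * K)"
    unfolding F_adj G_block
    by (subst mult_block_diag[OF one_carrier_mat V' E K]) (simp only: left_mult_one_mat[OF E])
  have FGF: "mat_adjoint F * G * F = four_block_mat E (0\<^sub>m 1 n1) (0\<^sub>m n1 1) (mat_adjoint V * K * V)"
    unfolding F'G unfolding F_def
    by (subst mult_block_diag[OF E V'K one_carrier_mat V]) (simp only: right_mult_one_mat[OF E])
  define U where "U = W * F"
  have U: "U \<in> carrier_mat n n"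
    unfolding U_def using W F by simp
  have U_adj: "mat_adjoint U = mat_adjoint F * mat_adjoint W"
    unfolding U_def using W F by (intro mat_adjoint_mult) auto
  have assoc: "X1 * X2 * (X3 * X4) = X1 * (X2 * X3) * X4"
      "X1 * X2 * X * (X3 * X4) = X1 * (X2 * X * X3) * X4"
    if "X1 \<in> carrier_mat n n" "X2 \<in> carrier_mat n n" "X3 \<in> carrier_mat n n"
      "X4 \<in> carrier_mat n n" "X \<in> carrier_mat n n"
    for X1 X2 X3 X4 X :: "complex mat"
    using that by (simp_all add: assoc_mult_mat[of _ n n _ n _ n])
  have "mat_adjoint U * U = mat_adjoint F * (mat_adjoint W * W) * F"
    unfolding U_adj unfolding U_def by (rule assoc(1)[OF F' W' W F H])
  also have "\<dots> = 1\<^sub>m n"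
    by (simp only: WW right_mult_one_mat[OF F'] FF)
  finally have UU: "mat_adjoint U * U = 1\<^sub>m n" .
  have "mat_adjoint U * H * U = mat_adjoint F * G * F"
    unfolding U_adj unfolding U_def G_def by (rule assoc(2)[OF F' W' W F H])
  also have "\<dots> = mat n n (\<lambda>(i, j). if i = j then (e # es) ! i else 0)"
    unfolding FGF VKV using n E by (intro eq_matI) (auto simp: E_def nth_Cons')
  finally show ?case
    using U UU by blast
qed

section \<open>Singular values above a level: counting and truncation\<close>

lemma nth_gt_iff_less_length_filter:
  fixes xs :: "'a :: linorder list"
  assumes "sorted_wrt (\<ge>) xs" "i < length xs"
  shows "xs ! i > M \<longleftrightarrow> i < length (filter (\<lambda>x. x > M) xs)"
  using assms
proof (induction xs arbitrary: i)
  case (Cons x xs)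
  show ?case
  proof (cases "x > M")
    case True
    then show ?thesis using Cons by (cases i) auto
  next
    case False
    then have "filter (\<lambda>x. x > M) xs = []"
      using Cons.prems by (force simp: filter_empty_conv)
    moreover have "\<not> (x # xs) ! i > M"
      using False Cons.prems by (cases i) (auto simp: not_less dest: order.trans)
    ultimately show ?thesis using False by simp
  qed
qed simp

text \<open>In a decreasing list the entries above \<open>M\<close> form an initial segment, so
  truncating the list to \<open>min_dim A\<close> entries truncates their number. Keeping the
  minimum avoids having to show that the dropped entries vanish.\<close>

lemma card_singular_values_greater:
  assumes "char_poly (mat_adjoint A * A) = (\<Prod>e\<leftarrow>es. [:- e, 1:])" "length es = dim_col A"
  shows "card {i. i < min_dim A \<and> singular_values A ! i > M} =
    min (min_dim A) (card {j. j < dim_col A \<and> sqrt (Re (es ! j)) > M})"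
proof -
  define L where "L = rev (sort (map (\<lambda>z. sqrt (Re z)) es))"
  let ?c = "length (filter (\<lambda>x. x > M) L)"
  have "(\<Prod>e\<leftarrow>xs. [:- e, 1:]) \<noteq> 0" for xs :: "complex list"
    by (induction xs) (simp_all del: mult_pCons_left mult_pCons_right)
  then have "proots (\<Prod>e\<leftarrow>es. [:- e, 1:]) = mset es"
    by (induction es) (simp_all add: proots_mult del: mult_pCons_left mult_pCons_right)
  then have sv: "singular_values A = take (min_dim A) L"
    unfolding singular_values_def assms(1) L_def by (simp flip: mset_map)
  have L: "sorted_wrt (\<ge>) L" "length L = dim_col A"
    by (auto simp: L_def sorted_wrt_rev assms(2))
  have "{i. i < min_dim A \<and> singular_values A ! i > M} = {..<min (min_dim A) ?c}"
    using nth_gt_iff_less_length_filter[OF L(1)] L(2) by (auto simp: sv)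
  moreover have "?c = card {j. j < dim_col A \<and> sqrt (Re (es ! j)) > M}"
  proof -
    have "?c = length (filter (\<lambda>x. x > M) (map (\<lambda>z. sqrt (Re z)) es))"
      by (simp add: L_def flip: rev_filter size_mset)
    also have "\<dots> = card {j. j < dim_col A \<and> sqrt (Re (es ! j)) > M}"
      unfolding length_filter_conv_card using assms(2) by (intro arg_cong[of _ _ card]) auto
    finally show ?thesis .
  qed
  ultimately show ?thesis by simp
qed

text \<open>Pythagoras: expanding the square, the cross terms carry off-diagonal Gram entries and
  vanish. The weights \<open>d\<close> are complex, hence the comparison of real parts at the end.
  It serves both for \<open>A * U\<close>, with eigenvalues as weights, and for the isometry
  \<open>mat_adjoint U\<close>, with weights 1.\<close>

lemma vec_norm2_orthogonal_columns:
  assumes C: "C \<in> carrier_mat nr nc" and x: "x \<in> carrier_vec nc"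
    and CC: "mat_adjoint C * C = mat nc nc (\<lambda>(i, j). if i = j then d i else 0)"
  shows "(vec_norm2 (C *\<^sub>v x))\<^sup>2 = (\<Sum>j<nc. Re (d j) * (cmod (x $ j))\<^sup>2)"
proof -
  have gram: "(\<Sum>i<nr. cnj (C $$ (i, j)) * C $$ (i, k)) = (if j = k then d j else 0)"
    if "j < nc" "k < nc" for j k
  proof -
    have "(mat_adjoint C * C) $$ (j, k) = (\<Sum>i<nr. cnj (C $$ (i, j)) * C $$ (i, k))"
      using C that by (subst index_mult_mat_sum) (auto simp: index_mat_adjoint)
    then show ?thesis
      unfolding CC using that by simp
  qed
  have "complex_of_real ((vec_norm2 (C *\<^sub>v x))\<^sup>2) =
      (\<Sum>i<nr. cnj (\<Sum>j<nc. C $$ (i, j) * x $ j) * (\<Sum>k<nc. C $$ (i, k) * x $ k))"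
    using C x by (simp add: vec_norm2_square index_mult_mat_vec_sum complex_norm_square mult.commute
        del: index_mult_mat_vec of_real_power)
  also have "\<dots> = (\<Sum>i<nr. \<Sum>j<nc. \<Sum>k<nc.
      cnj (x $ j) * x $ k * (cnj (C $$ (i, j)) * C $$ (i, k)))"
    unfolding cnj_sum sum_product by (intro sum.cong refl) simp
  also have "\<dots> = (\<Sum>j<nc. \<Sum>i<nr. \<Sum>k<nc.
      cnj (x $ j) * x $ k * (cnj (C $$ (i, j)) * C $$ (i, k)))"
    by (rule sum.swap)
  also have "\<dots> = (\<Sum>j<nc. \<Sum>k<nc. \<Sum>i<nr.
      cnj (x $ j) * x $ k * (cnj (C $$ (i, j)) * C $$ (i, k)))"
    by (intro sum.cong refl sum.swap)
  also have "\<dots> = (\<Sum>j<nc. \<Sum>k<nc. if j = k then cnj (x $ j) * x $ j * d j else 0)"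
    by (intro sum.cong refl) (simp add: gram flip: sum_distrib_left)
  also have "\<dots> = (\<Sum>j<nc. d j * complex_of_real ((cmod (x $ j))\<^sup>2))"
    by (simp add: complex_norm_square mult_ac del: of_real_power)
  finally have "Re (complex_of_real ((vec_norm2 (C *\<^sub>v x))\<^sup>2)) =
      Re (\<Sum>j<nc. d j * complex_of_real ((cmod (x $ j))\<^sup>2))"
    by simp
  then show ?thesis
    by (simp del: of_real_power)
qed

text \<open>A truncated singular value decomposition without left singular vectors. If
  \<open>U\<close> diagonalizes \<open>mat_adjoint A * A\<close>, then \<open>C = A * U\<close> has
  orthogonal columns whose squared norms are the eigenvalues, and
  \<open>A = C * mat_adjoint U\<close>. Columns of \<open>C\<close> with index in \<open>S\<close>
  give the low-rank part, the others the bounded part.\<close>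

lemma low_rank_plus_bounded_split:
  assumes "M > 0"
  shows "\<exists>H \<in> carrier_mat (dim_row A) (dim_col A). \<exists>T \<in> carrier_mat (dim_row A) (dim_col A).
    A = H + T \<and> mat_rank H \<le> card {i. i < min_dim A \<and> singular_values A ! i > M} \<and>
    spectral_norm T \<le> M"
proof -
  define d e where "d = dim_row A" and "e = dim_col A"
  have A: "A \<in> carrier_mat d e"
    by (simp add: d_def e_def)
  have A': "mat_adjoint A \<in> carrier_mat e d"
    using A by (rule mat_adjoint_carrier)
  have AA: "mat_adjoint A * A \<in> carrier_mat e e"
    by (rule mult_carrier_mat[OF A' A])
  obtain es where es: "char_poly (mat_adjoint A * A) = (\<Prod>a\<leftarrow>es. [:- a, 1:])" "length es = e"
    using char_poly_factorized[OF AA] by blast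
  define S where "S = {j. j < e \<and> sqrt (Re (es ! j)) > M}"
  have card_S: "card {i. i < min_dim A \<and> singular_values A ! i > M} = min (min_dim A) (card S)"
    unfolding S_def e_def by (rule card_singular_values_greater) (use es e_def in auto)
  show ?thesis
  proof (cases "card S \<le> min_dim A")
    case False \<comment> \<open>impossible, but it is easier to take \<open>T = 0\<close>\<close>
    have "A = A + 0\<^sub>m (dim_row A) (dim_col A)"
      by simp
    moreover have "mat_rank A \<le> card {i. i < min_dim A \<and> singular_values A ! i > M}"
      unfolding card_S using False mat_rank_le_min_dim[of A] by linarith
    moreover have "spectral_norm (0\<^sub>m (dim_row A) (dim_col A)) \<le> M"
      using assms by (intro spectral_norm_le) (auto simp: vec_norm2_def L2_set_0')
    ultimately show ?thesis
      by (intro bexI[of _ A] bexI[of _ "0\<^sub>m (dim_row A) (dim_col A)"]) auto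
  next
    case True
    have "mat_adjoint (mat_adjoint A * A) = mat_adjoint A * A"
      by (simp add: mat_adjoint_mult)
    from hermitian_unitary_diagonalization[OF AA this es(1)]
    obtain U where U: "U \<in> carrier_mat e e" and UU: "mat_adjoint U * U = 1\<^sub>m e"
      and diag: "mat_adjoint U * (mat_adjoint A * A) * U =
        mat e e (\<lambda>(i, j). if i = j then es ! i else 0)"
      by blast
    have U': "mat_adjoint U \<in> carrier_mat e e"
      using U by (rule mat_adjoint_carrier)
    have UU': "U * mat_adjoint U = 1\<^sub>m e"
      by (rule mat_mult_left_right_inverse[OF U' U UU])
    define C where "C = A * U"
    have C: "C \<in> carrier_mat d e"
      unfolding C_def using A U by simp
    have "mat_adjoint C * C = (mat_adjoint U * mat_adjoint A) * (A * U)"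
      using A U by (simp add: C_def mat_adjoint_mult)
    also have "\<dots> = mat_adjoint U * (mat_adjoint A * (A * U))"
      by (rule assoc_mult_mat[OF U' A' C[unfolded C_def]])
    also have "mat_adjoint A * (A * U) = mat_adjoint A * A * U"
      by (rule assoc_mult_mat[OF A' A U, symmetric])
    also have "mat_adjoint U * \<dots> = mat_adjoint U * (mat_adjoint A * A) * U"
      by (rule assoc_mult_mat[OF U' AA U, symmetric])
    finally have CC: "mat_adjoint C * C = mat e e (\<lambda>(i, j). if i = j then es ! i else 0)"
      unfolding diag .
    \<comment> \<open>\<open>P\<close> and \<open>Q\<close> keep complementary sets of rows of
      \<open>mat_adjoint U\<close>, so multiplying by \<open>C\<close> selects the columns of
      \<open>C\<close> inside and outside \<open>S\<close>.\<close>
    define P where "P = mat e e (\<lambda>(j, i). if j \<in> S then mat_adjoint U $$ (j, i) else 0)"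
    define Q where "Q = mat e e (\<lambda>(j, i). if j \<in> S then 0 else mat_adjoint U $$ (j, i))"
    have P: "P \<in> carrier_mat e e" and Q: "Q \<in> carrier_mat e e"
      unfolding P_def Q_def by auto
    have "P + Q = mat_adjoint U"
      using U by (intro eq_matI) (auto simp: P_def Q_def)
    then have "C * P + C * Q = A * U * mat_adjoint U"
      using C P Q by (simp add: C_def flip: mult_add_distrib_mat[of _ d e])
    also have "\<dots> = A"
      using A by (simp add: assoc_mult_mat[OF A U U'] UU')
    finally have split: "A = C * P + C * Q"
      by simp
    have rank: "vec_space.rank d (C * P) \<le> card S"
    proof (rule rank_le_card_sum_products[where nc = e and f = "\<lambda>l i. C $$ (i, l)"
          and g = "\<lambda>l j. mat_adjoint U $$ (l, j)"])
      show "finite S" by (simp add: S_def)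
      show "C * P \<in> carrier_mat d e" using C P by simp
      fix i j assume ij: "i < d" "j < e"
      have "(C * P) $$ (i, j) = (\<Sum>l<e. if l \<in> S then C $$ (i, l) * mat_adjoint U $$ (l, j) else 0)"
        using C P ij by (subst index_mult_mat_sum) (auto simp: P_def intro!: sum.cong)
      also have "\<dots> = (\<Sum>l\<in>S. C $$ (i, l) * mat_adjoint U $$ (l, j))"
        by (rule sum.mono_neutral_cong_right) (auto simp: S_def)
      finally show "(C * P) $$ (i, j) = (\<Sum>l\<in>S. C $$ (i, l) * mat_adjoint U $$ (l, j))" .
    qed
    have norm: "spectral_norm (C * Q) \<le> M"
    proof (rule spectral_norm_le)
      fix x :: "complex vec" assume "x \<in> carrier_vec (dim_col (C * Q))"
      then have x: "x \<in> carrier_vec e" using Q by simp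
      define y where "y = mat_adjoint U *\<^sub>v x"
      have y: "y \<in> carrier_vec e"
        unfolding y_def using U' x by simp
      have Qx: "(Q *\<^sub>v x) $ j = (if j \<in> S then 0 else y $ j)" if "j < e" for j
        using that x Q U unfolding y_def
        by (auto simp: index_mult_mat_vec_sum Q_def simp del: index_mult_mat_vec)
      have "(vec_norm2 ((C * Q) *\<^sub>v x))\<^sup>2 = (vec_norm2 (C *\<^sub>v (Q *\<^sub>v x)))\<^sup>2"
        using C Q x by (simp add: assoc_mult_mat_vec[of C d e Q e x])
      also have "\<dots> = (\<Sum>j<e. Re (es ! j) * (cmod ((Q *\<^sub>v x) $ j))\<^sup>2)"
        using C Q x CC by (intro vec_norm2_orthogonal_columns[where nr = d]) auto
      also have "\<dots> \<le> (\<Sum>j<e. M\<^sup>2 * (cmod (y $ j))\<^sup>2)"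
      proof (rule sum_mono)
        fix j assume "j \<in> {..<e}"
        then have j: "j < e" by simp
        \<comment> \<open>The implication from \<open>sqrt x \<le> M\<close> to
          \<open>x \<le> M\<^sup>2\<close> holds for negative \<open>x\<close> too, so the sign of
          the eigenvalues never has to be discussed.\<close>
        have "Re (es ! j) \<le> M\<^sup>2" if "j \<notin> S"
          using that j assms real_le_lsqrt[of M] sqrt_le_D[of "Re (es ! j)" M] by (simp add: S_def not_less)
        then show "Re (es ! j) * (cmod ((Q *\<^sub>v x) $ j))\<^sup>2 \<le> M\<^sup>2 * (cmod (y $ j))\<^sup>2"
          unfolding Qx[OF j] by (auto intro!: mult_right_mono)
      qed
      also have "\<dots> = M\<^sup>2 * (vec_norm2 y)\<^sup>2"
        using y by (simp add: vec_norm2_square sum_distrib_left)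
      \<comment> \<open>The Gram matrix of \<open>mat_adjoint U\<close> is
        \<open>U * mat_adjoint U\<close>, the identity, so passing from \<open>x\<close> to
        \<open>y\<close> preserves the norm.\<close>
      also have "(vec_norm2 y)\<^sup>2 = (\<Sum>j<e. Re 1 * (cmod (x $ j))\<^sup>2)"
        unfolding y_def
        by (rule vec_norm2_orthogonal_columns[OF U' x, where d = "\<lambda>_. 1"])
          (use UU' in \<open>auto simp: one_mat_def\<close>)
      also have "\<dots> = (vec_norm2 x)\<^sup>2"
        using x by (simp add: vec_norm2_square)
      finally have "(vec_norm2 ((C * Q) *\<^sub>v x))\<^sup>2 \<le> (M * vec_norm2 x)\<^sup>2"
        by (simp add: power_mult_distrib)
      then show "vec_norm2 ((C * Q) *\<^sub>v x) \<le> M * vec_norm2 x"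
        by (rule power2_le_imp_le) (use assms in simp)
    qed (use assms in simp)
    have "C * P \<in> carrier_mat d e" "C * Q \<in> carrier_mat d e"
      by (rule mult_carrier_mat[OF C P], rule mult_carrier_mat[OF C Q])
    moreover have "mat_rank (C * P) \<le> card {i. i < min_dim A \<and> singular_values A ! i > M}"
      unfolding card_S min_absorb2[OF True] using rank C by simp
    ultimately show ?thesis
      unfolding d_def e_def using split norm by blast
  qed
qed

section \<open>Perturbation of Kronecker products\<close>

lemma kronecker_carrier:
  "X \<in> carrier_mat d e \<Longrightarrow> Y \<in> carrier_mat d' e' \<Longrightarrow> X \<otimes>\<^sub>K Y \<in> carrier_mat (d * d') (e * e')"
  by (metis carrier_matD carrier_matI dim_kronecker)

text \<open>Every term of the first bracket has a factor of small rank; the second bracket collects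
  the terms with two bounded factors. Signs are moved into \<open>- N'\<close> so that subadditivity
  of rank and norm applies to plain sums. The identity is checked entrywise, where it becomes a
  polynomial identity in complex numbers.\<close>

lemma kronecker_difference_split:
  fixes B R N H T B' R' N' H' T' :: "complex mat"
  assumes "A = B + R + N" "A = H + T" "A' = B' + R' + N'" "A' = H' + T'"
    and B: "B \<in> carrier_mat d e" "R \<in> carrier_mat d e" "N \<in> carrier_mat d e"
      "H \<in> carrier_mat d e" "T \<in> carrier_mat d e"
    and B': "B' \<in> carrier_mat d' e'" "R' \<in> carrier_mat d' e'" "N' \<in> carrier_mat d' e'"
      "H' \<in> carrier_mat d' e'" "T' \<in> carrier_mat d' e'"
  shows "A \<otimes>\<^sub>K A' = B \<otimes>\<^sub>K B'
    + (R \<otimes>\<^sub>K A' + N \<otimes>\<^sub>K H' + B \<otimes>\<^sub>K R' + H \<otimes>\<^sub>K N' + R \<otimes>\<^sub>K (- N'))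
    + (N \<otimes>\<^sub>K T' + T \<otimes>\<^sub>K N' + N \<otimes>\<^sub>K (- N'))" (is "_ = ?rhs")
proof (rule eq_matI)
  have A: "A \<in> carrier_mat d e" and A': "A' \<in> carrier_mat d' e'"
    unfolding assms(2,4) using B B' by auto
  show "dim_row (A \<otimes>\<^sub>K A') = dim_row ?rhs" "dim_col (A \<otimes>\<^sub>K A') = dim_col ?rhs"
    using A A' B B' by auto
  fix r s assume "r < dim_row ?rhs" "s < dim_col ?rhs"
  then have rs: "r < d * d'" "s < e * e'"
    using B B' by auto
  obtain i k j l where ikjl: "i = r div d'" "k = r mod d'" "j = s div e'" "l = s mod e'"
    by blast
  have lt: "i < d" "k < d'" "j < e" "l < e'"
    using rs by (simp_all add: ikjl div_mod_less_mult)
  have kron: "(X \<otimes>\<^sub>K Y) $$ (r, s) = X $$ (i, j) * Y $$ (k, l)"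
    if "X \<in> carrier_mat d e" "Y \<in> carrier_mat d' e'" for X Y
    using that rs by (auto simp: index_kronecker ikjl)
  have eqs: "A $$ (i, j) = B $$ (i, j) + R $$ (i, j) + N $$ (i, j)"
    "A' $$ (k, l) = B' $$ (k, l) + R' $$ (k, l) + N' $$ (k, l)"
    using B B' lt by (simp_all add: assms(1,3))
  have "A $$ (i, j) = H $$ (i, j) + T $$ (i, j)" "A' $$ (k, l) = H' $$ (k, l) + T' $$ (k, l)"
    using B B' lt by (simp_all add: assms(2,4))
  then have eqs': "T $$ (i, j) = A $$ (i, j) - H $$ (i, j)" "T' $$ (k, l) = A' $$ (k, l) - H' $$ (k, l)"
    by simp_all
  have N': "- N' \<in> carrier_mat d' e'" "(- N') $$ (k, l) = - N' $$ (k, l)"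
    using B' lt by auto
  have "?rhs $$ (r, s) = B $$ (i, j) * B' $$ (k, l)
    + (R $$ (i, j) * A' $$ (k, l) + N $$ (i, j) * H' $$ (k, l) + B $$ (i, j) * R' $$ (k, l)
      + H $$ (i, j) * N' $$ (k, l) + R $$ (i, j) * - N' $$ (k, l))
    + (N $$ (i, j) * T' $$ (k, l) + T $$ (i, j) * N' $$ (k, l) + N $$ (i, j) * - N' $$ (k, l))"
    using rs A A' B B' N' by (simp add: kron)
  \<comment> \<open>Eliminating \<open>T\<close> and \<open>T'\<close> first and then expanding
    \<open>A\<close> and \<open>A'\<close> leaves only independent entries.\<close>
  also have "\<dots> = A $$ (i, j) * A' $$ (k, l)"
    unfolding eqs' unfolding eqs by (simp add: algebra_simps)
  finally show "(A \<otimes>\<^sub>K A') $$ (r, s) = ?rhs $$ (r, s)"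
    using A A' by (simp add: kron)
qed

lemma spectral_norm_uminus_le: "spectral_norm (- A) \<le> spectral_norm A"
proof (rule spectral_norm_le)
  fix x :: "complex vec" assume "x \<in> carrier_vec (dim_col (- A))"
  then have x: "x \<in> carrier_vec (dim_col A)" by simp
  have "vec_norm2 ((- A) *\<^sub>v x) = vec_norm2 (A *\<^sub>v x)"
    unfolding vec_norm2_def using x
    by (intro L2_set_cong)
      (auto simp: index_mult_mat_vec_sum sum_negf simp del: index_mult_mat_vec)
  then show "vec_norm2 ((- A) *\<^sub>v x) \<le> spectral_norm A * vec_norm2 x"
    using vec_norm2_mult_mat_vec_le[OF x] by simp
qed (rule spectral_norm_nonneg)

lemma mat_rank_kronecker_le_mult:
  assumes "X \<in> carrier_mat d e" "Y \<in> carrier_mat d' e'"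
    and "real (mat_rank X) \<le> a" "real (mat_rank Y) \<le> b"
  shows "real (vec_space.rank (d * d') (X \<otimes>\<^sub>K Y)) \<le> a * b"
proof -
  have "real (vec_space.rank (d * d') (X \<otimes>\<^sub>K Y)) \<le> real (mat_rank X) * real (mat_rank Y)"
    using mat_rank_kronecker_le[of X Y] assms(1,2)
    by (metis carrier_matD(1) dim_kronecker(1) of_nat_le_iff of_nat_mult)
  also have "\<dots> \<le> a * b"
    using assms(3,4) by (intro mult_mono) auto
  finally show ?thesis .
qed

text \<open>The quantitative estimate for a single pair of matrices. In the rank coefficient,
  \<open>R\<close> occurs in two products and gives \<open>2 * c\<close>, while \<open>R'\<close>,
  \<open>H\<close> and \<open>H'\<close> give \<open>c'\<close>, \<open>r\<close> and
  \<open>r'\<close>. The norm bound has one term for each of the three products in the second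
  bracket of \<open>kronecker_difference_split\<close>.\<close>

lemma kronecker_perturbation:
  fixes c r w c' r' w' M :: real
  defines "k \<equiv> (\<lambda>A. card {i. i < min_dim A \<and> singular_values A ! i > M})"
  assumes A: "A = B + R + N" "B \<in> carrier_mat d e" "R \<in> carrier_mat d e" "N \<in> carrier_mat d e"
    and A': "A' = B' + R' + N'" "B' \<in> carrier_mat d' e'" "R' \<in> carrier_mat d' e'"
      "N' \<in> carrier_mat d' e'"
    and R: "real (mat_rank R) \<le> c * min_dim A" and R': "real (mat_rank R') \<le> c' * min_dim A'"
    and N: "spectral_norm N \<le> w" and N': "spectral_norm N' \<le> w'"
    and k: "real (k A) \<le> r * min_dim A" and k': "real (k A') \<le> r' * min_dim A'"
    and nonneg: "0 \<le> c" "0 \<le> c'" "0 \<le> r" "0 \<le> r'" and M: "0 < M"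
  shows "\<exists>R'' \<in> carrier_mat (d * d') (e * e'). \<exists>N'' \<in> carrier_mat (d * d') (e * e').
    A \<otimes>\<^sub>K A' = B \<otimes>\<^sub>K B' + R'' + N'' \<and>
    real (mat_rank R'') \<le> (2 * c + c' + r + r') * min_dim (A \<otimes>\<^sub>K A') \<and>
    spectral_norm N'' \<le> w * M + M * w' + w * w'"
proof -
  have cA: "A \<in> carrier_mat d e" and cA': "A' \<in> carrier_mat d' e'"
    using A A' by auto
  obtain H T where H: "H \<in> carrier_mat d e" "T \<in> carrier_mat d e" "A = H + T"
    "mat_rank H \<le> k A" "spectral_norm T \<le> M"
    using low_rank_plus_bounded_split[OF M, of A] cA unfolding k_def by auto
  obtain H' T' where H': "H' \<in> carrier_mat d' e'" "T' \<in> carrier_mat d' e'" "A' = H' + T'"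
    "mat_rank H' \<le> k A'" "spectral_norm T' \<le> M"
    using low_rank_plus_bounded_split[OF M, of A'] cA' unfolding k_def by auto
  have mN': "- N' \<in> carrier_mat d' e'"
    using A' by simp
  let ?m = "real (min d e)" and ?m' = "real (min d' e')"
  let ?K = "carrier_mat (d * d') (e * e')"
  let ?rk = "vec_space.rank (d * d') :: complex mat \<Rightarrow> nat"
  have full: "real (mat_rank X) \<le> ?m" if "X \<in> carrier_mat d e" for X
    using mat_rank_le_min_dim[of X] that by auto
  have full': "real (mat_rank X) \<le> ?m'" if "X \<in> carrier_mat d' e'" for X
    using mat_rank_le_min_dim[of X] that by auto
  define S1 where "S1 = R \<otimes>\<^sub>K A'"
  define S2 where "S2 = N \<otimes>\<^sub>K H'"
  define S3 where "S3 = B \<otimes>\<^sub>K R'"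
  define S4 where "S4 = H \<otimes>\<^sub>K N'"
  define S5 where "S5 = R \<otimes>\<^sub>K (- N')"
  define U1 where "U1 = N \<otimes>\<^sub>K T'"
  define U2 where "U2 = T \<otimes>\<^sub>K N'"
  define U3 where "U3 = N \<otimes>\<^sub>K (- N')"
  note defs = S1_def S2_def S3_def S4_def S5_def U1_def U2_def U3_def
  have carr: "S1 \<in> ?K" "S2 \<in> ?K" "S3 \<in> ?K" "S4 \<in> ?K" "S5 \<in> ?K" "U1 \<in> ?K" "U2 \<in> ?K" "U3 \<in> ?K"
    unfolding defs using A A' H H' mN' cA' by (simp_all add: kronecker_carrier)
  define R'' where "R'' = S1 + S2 + S3 + S4 + S5"
  define N'' where "N'' = U1 + U2 + U3"
  have carr'': "R'' \<in> ?K" "N'' \<in> ?K"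
    unfolding R''_def N''_def using carr by auto
  have split: "A \<otimes>\<^sub>K A' = B \<otimes>\<^sub>K B' + R'' + N''"
    unfolding R''_def N''_def defs
    by (rule kronecker_difference_split[OF A(1) H(3) A'(1) H'(3)]) (use A A' H H' in auto)
  have rH: "real (mat_rank H) \<le> r * ?m" and rH': "real (mat_rank H') \<le> r' * ?m'"
    using k k' H(4) H'(4) cA cA' by auto
  have rR: "real (mat_rank R) \<le> c * ?m" and rR': "real (mat_rank R') \<le> c' * ?m'"
    using R R' cA cA' by auto
  have "?rk R'' \<le> ?rk S1 + ?rk S2 + ?rk S3 + ?rk S4 + ?rk S5"
    unfolding R''_def using carr
    by (intro order.trans[OF vec_space.rank_subadditive[of _ _ "e * e'"]] add_mono order.refl) auto
  then have "real (?rk R'') \<le> real (?rk S1) + ?rk S2 + ?rk S3 + ?rk S4 + ?rk S5"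
    by linarith
  \<comment> \<open>In each product one factor has small rank, and the other is bounded by its
    smaller dimension.\<close>
  also have "\<dots> \<le> (c * ?m) * ?m' + ?m * (r' * ?m') + ?m * (c' * ?m') + (r * ?m) * ?m' + (c * ?m) * ?m'"
    unfolding defs using A A' H H' cA' mN' rH rH' rR rR' full full'
    by (intro add_mono mat_rank_kronecker_le_mult) auto
  also have "\<dots> = (2 * c + c' + r + r') * (?m * ?m')"
    by (simp add: algebra_simps)
  also have "\<dots> \<le> (2 * c + c' + r + r') * min_dim (A \<otimes>\<^sub>K A')"
  proof (rule mult_left_mono)
    \<comment> \<open>The inequality can be strict for rectangular matrices. It points the right way
      because the coefficient in front is nonnegative.\<close>
    have "min d e * min d' e' \<le> min (d * d') (e * e')"
      by (simp add: mult_le_mono)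
    then show "?m * ?m' \<le> real (min_dim (A \<otimes>\<^sub>K A'))"
      using cA cA' by (metis carrier_matD dim_kronecker of_nat_le_iff of_nat_mult)
  qed (use nonneg in simp)
  finally have rank: "real (?rk R'') \<le> (2 * c + c' + r + r') * min_dim (A \<otimes>\<^sub>K A')" .
  have kron_norm: "spectral_norm (X \<otimes>\<^sub>K Y) \<le> a * b" if "spectral_norm X \<le> a" "spectral_norm Y \<le> b" for X Y a b
    using that spectral_norm_kronecker_le[of X Y] spectral_norm_nonneg[of X] spectral_norm_nonneg[of Y]
    by (meson mult_mono order.trans)
  have "spectral_norm N'' \<le> spectral_norm U1 + spectral_norm U2 + spectral_norm U3"
    unfolding N''_def using carr
    by (intro order.trans[OF spectral_norm_add_le[of _ "d * d'" "e * e'"]] add_mono order.refl) auto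
  also have "\<dots> \<le> w * M + M * w' + w * w'"
    unfolding defs using N N' H(5) H'(5) spectral_norm_uminus_le[of N']
    by (intro add_mono kron_norm) auto
  finally have "spectral_norm N'' \<le> w * M + M * w' + w * w'" .
  then show ?thesis
    using split rank carr'' by (metis carrier_matD(1))
qed

section \<open>Passage from single matrices to sequences\<close>

lemma matrix_sequence_kronecker:
  assumes A: "matrix_sequence I A" and A': "matrix_sequence I A'"
  shows "matrix_sequence I (\<lambda>n. A n \<otimes>\<^sub>K A' n)"
proof -
  have *: "filterlim (\<lambda>n. f n * g n) at_top F" if "filterlim f at_top F" "filterlim g at_top F"
    for f g :: "nat \<Rightarrow> nat" and F
  proof (rule filterlim_at_top_mono[OF that(1)])
    have "\<forall>\<^sub>F n in F. 1 \<le> g n"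
      using that(2) by (simp add: filterlim_at_top)
    then show "\<forall>\<^sub>F n in F. f n \<le> f n * g n"
      by eventually_elim simp
  qed
  show ?thesis
    using assms unfolding matrix_sequence_def by (auto intro: *)
qed

theorem theorem5p1:
  fixes I :: "nat set"
    and A A' :: "nat \<Rightarrow> complex mat"
    and B B' :: "nat \<Rightarrow> nat \<Rightarrow> complex mat"
  assumes "sparsely_unbounded I A"
    and "sparsely_unbounded I A'"
    and "acs I B A"
    and "acs I B' A'"
  shows "acs I (\<lambda>n m. B n m \<otimes>\<^sub>K B' n m) (\<lambda>n. A n \<otimes>\<^sub>K A' n)"
proof -
  define k where "k M X = card {i. i < min_dim X \<and> singular_values X ! i > M}"
    for M :: real and X :: "complex mat"
  \<comment> \<open>The absolute value provides the nonnegative coefficient that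
    \<open>kronecker_perturbation\<close> asks for. If \<open>min_dim X = 0\<close>, the quotient is
    0 by convention and carries no information, but then the count itself is 0.\<close>
  have count: "real (k M X) \<le> \<bar>r\<bar> * min_dim X" if "real (k M X) / real (min_dim X) \<le> r" for M X r
  proof (cases "min_dim X = 0")
    case True
    then show ?thesis by (simp add: k_def)
  next
    case False
    have "real (k M X) \<le> r * min_dim X"
      using that False by (simp add: pos_divide_le_eq)
    also have "\<dots> \<le> \<bar>r\<bar> * min_dim X"
      by (intro mult_right_mono) auto
    finally show ?thesis .
  qed
  obtain r where r: "(r \<longlongrightarrow> 0) at_top"
    and su: "\<And>M. M > 0 \<Longrightarrow> \<exists>n0. \<forall>n\<in>I. n \<ge> n0 \<longrightarrow> real (k M (A n)) / real (min_dim (A n)) \<le> r M"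
    using assms(1) unfolding sparsely_unbounded_def k_def by blast
  obtain r' where r': "(r' \<longlongrightarrow> 0) at_top"
    and su': "\<And>M. M > 0 \<Longrightarrow> \<exists>n0. \<forall>n\<in>I. n \<ge> n0 \<longrightarrow> real (k M (A' n)) / real (min_dim (A' n)) \<le> r' M"
    using assms(2) unfolding sparsely_unbounded_def k_def by blast
  define good where "good X Y c w \<longleftrightarrow>
    (\<exists>R \<in> carrier_mat (dim_row X) (dim_col X). \<exists>N \<in> carrier_mat (dim_row X) (dim_col X).
      X = Y + R + N \<and> real (mat_rank R) \<le> c * real (min_dim X) \<and> spectral_norm N \<le> w)"
    for X Y :: "complex mat" and c w :: real
  have seq: "matrix_sequence I A" "matrix_sequence I A'"
    and carr: "\<And>m n. m \<ge> 1 \<Longrightarrow> n \<in> I \<Longrightarrow> B n m \<in> carrier_mat (dim_row (A n)) (dim_col (A n))"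
      "\<And>m n. m \<ge> 1 \<Longrightarrow> n \<in> I \<Longrightarrow> B' n m \<in> carrier_mat (dim_row (A' n)) (dim_col (A' n))"
    using assms(3,4) unfolding acs_def by blast+
  obtain c w where c: "c \<longlonglongrightarrow> 0" and w: "w \<longlonglongrightarrow> 0"
    and acs: "\<And>m. m \<ge> 1 \<Longrightarrow> \<exists>n0. \<forall>n\<in>I. n \<ge> n0 \<longrightarrow> good (A n) (B n m) (c m) (w m)"
    using assms(3) unfolding acs_def good_def by blast
  obtain c' w' where c': "c' \<longlonglongrightarrow> 0" and w': "w' \<longlonglongrightarrow> 0"
    and acs': "\<And>m. m \<ge> 1 \<Longrightarrow> \<exists>n0. \<forall>n\<in>I. n \<ge> n0 \<longrightarrow> good (A' n) (B' n m) (c' m) (w' m)"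
    using assms(4) unfolding acs_def good_def by blast
  \<comment> \<open>The summand \<open>inverse (Suc m)\<close> only keeps \<open>s m\<close> positive.\<close>
  define s where "s m = \<bar>w m\<bar> + \<bar>w' m\<bar> + inverse (real (Suc m))" for m
  \<comment> \<open>The exponent -1/2 balances two demands: \<open>M m\<close> tends to infinity, so
    that \<open>r (M m)\<close> and \<open>r' (M m)\<close> vanish, while
    \<open>s m * M m = sqrt (s m)\<close> still tends to 0.\<close>
  define M where "M m = inverse (sqrt (s m))" for m
  have s_pos: "s m > 0" for m
    unfolding s_def by (intro add_nonneg_pos) auto
  then have M_pos: "M m > 0" for m
    by (simp add: M_def)
  have s_lim: "s \<longlonglongrightarrow> 0"
    unfolding s_def using tendsto_add[OF tendsto_add[OF tendsto_rabs_zero[OF w] tendsto_rabs_zero[OF w']]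
      LIMSEQ_inverse_real_of_nat] by simp
  have sqrt_lim: "(\<lambda>m. sqrt (s m)) \<longlonglongrightarrow> 0"
    using tendsto_real_sqrt[OF s_lim] by simp
  have M_lim: "filterlim M at_top sequentially"
    unfolding M_def using s_pos
    by (intro filterlim_inverse_at_top[OF sqrt_lim]) auto
  \<comment> \<open>The rank coefficient of \<open>kronecker_perturbation\<close> at level
    \<open>M m\<close>, with absolute values to secure nonnegativity. In \<open>w''\<close>, the
    term \<open>sqrt (s m)\<close> absorbs the two products with \<open>M m\<close>, and
    \<open>s m * s m\<close> absorbs \<open>w m * w' m\<close>.\<close>
  define c'' where "c'' m = 2 * \<bar>c m\<bar> + \<bar>c' m\<bar> + \<bar>r (M m)\<bar> + \<bar>r' (M m)\<bar>" for m
  define w'' where "w'' m = sqrt (s m) + s m * s m" for m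
  have "c'' \<longlonglongrightarrow> 2 * 0 + 0 + 0 + 0"
    unfolding c''_def
    by (intro tendsto_add tendsto_mult tendsto_const tendsto_rabs_zero c c'
        filterlim_compose[OF r M_lim] filterlim_compose[OF r' M_lim])
  then have c''_lim: "c'' \<longlonglongrightarrow> 0" by simp
  have w''_lim: "w'' \<longlonglongrightarrow> 0"
    unfolding w''_def using tendsto_add[OF sqrt_lim tendsto_mult[OF s_lim s_lim]] by simp
  have w_bound: "w m * M m + M m * w' m + w m * w' m \<le> w'' m" for m
  proof -
    have "w m * M m + M m * w' m \<le> s m * M m"
    proof -
      have "w m + w' m \<le> s m"
        unfolding s_def by (smt (verit) inverse_nonnegative_iff_nonnegative of_nat_0_le_iff)
      then show ?thesis
        using M_pos[of m] mult_right_mono[of "w m + w' m" "s m" "M m"] by (simp add: algebra_simps)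
    qed
    also have "s m * M m = sqrt (s m)"
      using s_pos[of m] by (simp add: M_def real_div_sqrt flip: divide_inverse)
    finally have "w m * M m + M m * w' m \<le> sqrt (s m)" .
    moreover have "w m * w' m \<le> s m * s m"
    proof -
      have "w m * w' m \<le> \<bar>w m\<bar> * \<bar>w' m\<bar>"
        by (metis abs_ge_self abs_mult)
      also have "\<dots> \<le> s m * s m"
        unfolding s_def by (intro mult_mono) auto
      finally show ?thesis .
    qed
    ultimately show ?thesis
      by (simp add: w''_def)
  qed
  have step: "good (A n \<otimes>\<^sub>K A' n) (B n m \<otimes>\<^sub>K B' n m) (c'' m) (w'' m)"
    if hyp: "good (A n) (B n m) (c m) (w m)" "good (A' n) (B' n m) (c' m) (w' m)" "m \<ge> 1" "n \<in> I"
      "real (k (M m) (A n)) / real (min_dim (A n)) \<le> r (M m)"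
      "real (k (M m) (A' n)) / real (min_dim (A' n)) \<le> r' (M m)" for m n
  proof -
    obtain R N where R: "R \<in> carrier_mat (dim_row (A n)) (dim_col (A n))"
      "N \<in> carrier_mat (dim_row (A n)) (dim_col (A n))" "A n = B n m + R + N"
      "real (mat_rank R) \<le> c m * real (min_dim (A n))" "spectral_norm N \<le> w m"
      using hyp(1) unfolding good_def by blast
    obtain R' N' where R': "R' \<in> carrier_mat (dim_row (A' n)) (dim_col (A' n))"
      "N' \<in> carrier_mat (dim_row (A' n)) (dim_col (A' n))" "A' n = B' n m + R' + N'"
      "real (mat_rank R') \<le> c' m * real (min_dim (A' n))" "spectral_norm N' \<le> w' m"
      using hyp(2) unfolding good_def by blast
    have rank: "real (mat_rank R) \<le> \<bar>c m\<bar> * real (min_dim (A n))"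
      using R(4) by (rule order.trans) (intro mult_right_mono, auto)
    have rank': "real (mat_rank R') \<le> \<bar>c' m\<bar> * real (min_dim (A' n))"
      using R'(4) by (rule order.trans) (intro mult_right_mono, auto)
    obtain R'' N''
      where "R'' \<in> carrier_mat (dim_row (A n) * dim_row (A' n)) (dim_col (A n) * dim_col (A' n))"
      "N'' \<in> carrier_mat (dim_row (A n) * dim_row (A' n)) (dim_col (A n) * dim_col (A' n))"
      "A n \<otimes>\<^sub>K A' n = B n m \<otimes>\<^sub>K B' n m + R'' + N''"
      "real (mat_rank R'') \<le> c'' m * min_dim (A n \<otimes>\<^sub>K A' n)"
      "spectral_norm N'' \<le> w m * M m + M m * w' m + w m * w' m"
      using kronecker_perturbation[OF R(3) carr(1)[OF hyp(3,4)] R(1,2) R'(3) carr(2)[OF hyp(3,4)] R'(1,2)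
        rank rank' R(5) R'(5) count[OF hyp(5), unfolded k_def] count[OF hyp(6), unfolded k_def]
        abs_ge_zero abs_ge_zero abs_ge_zero abs_ge_zero M_pos, folded c''_def] by blast
    then show ?thesis
      using w_bound[of m] unfolding good_def dim_kronecker by (meson order.trans)
  qed
  \<comment> \<open>Once \<open>m\<close> is fixed, \<open>M m\<close> is a constant, so the
    thresholds supplied by sparse unboundedness depend on \<open>m\<close> alone. The sum of the
    four thresholds dominates each of them.\<close>
  have "\<exists>n0. \<forall>n\<in>I. n \<ge> n0 \<longrightarrow> good (A n \<otimes>\<^sub>K A' n) (B n m \<otimes>\<^sub>K B' n m) (c'' m) (w'' m)"
    if m: "m \<ge> 1" for m
  proof -
    obtain n1 n2 n3 n4 where
      "\<forall>n\<in>I. n \<ge> n1 \<longrightarrow> good (A n) (B n m) (c m) (w m)"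
      "\<forall>n\<in>I. n \<ge> n2 \<longrightarrow> good (A' n) (B' n m) (c' m) (w' m)"
      "\<forall>n\<in>I. n \<ge> n3 \<longrightarrow> real (k (M m) (A n)) / real (min_dim (A n)) \<le> r (M m)"
      "\<forall>n\<in>I. n \<ge> n4 \<longrightarrow> real (k (M m) (A' n)) / real (min_dim (A' n)) \<le> r' (M m)"
      using acs[OF m] acs'[OF m] su[OF M_pos[of m]] su'[OF M_pos[of m]] by blast
    then show ?thesis
      using step[OF _ _ m] by (intro exI[of _ "n1 + n2 + n3 + n4"]) auto
  qed
  then show ?thesis
    unfolding acs_def good_def
    using matrix_sequence_kronecker[OF seq] c''_lim w''_lim carr
    by (intro conjI exI[of _ c''] exI[of _ w''] allI impI ballI)
      (auto intro: kronecker_carrier)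
qed

end
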